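(* (Dual functional property.) Let $a,b\in\mathbb R$ with $d(a-jh,b-ih)\neq0$ for $0\le i\le j\le n-1$. Let $G\in\pi_n(\gamma_1,\gamma_2)$ and let $g$ be the $h$--$\gamma$ blossom of $G$. Then the Bernstein--B\'ezier control points of $G$ over $[a,b]$, i.e. the coefficients $b_k$ in $G(x)=\sum_{k=0}^nb_kB_k^n(x,[a,b];\gamma,h)$, are given by $$b_k=g\big(\Gamma(a-kh),\ldots,\Gamma(a-(n-1)h),\Gamma(b),\Gamma(b-h),\ldots,\Gamma(b-(k-1)h);h\big),\quad k=0,\ldots,n.$$
   Context: Let $n\ge 1$ be an integer and $h\in\mathbb R$ fixed. Let $\gamma_1,\gamma_2:\mathbb R\to\mathbb R$ be continuous, linearly independent functions, and write $\Gamma(t)=(\gamma_1(t),\gamma_2(t))$. They are assumed translation invariant: for every $s\in\mathbb R$ there is an invertible $2\times2$ matrix $C(s)$ with $\begin{pmatrix}\gamma_1(x-s)\\ \gamma_2(x-s)\end{pmatrix}=C(s)\begin{pmatrix}\gamma_1(x)\\ \gamma_2(x)\end{pmatrix}$ for all $x$. Put $\pi_n(\gamma_1,\gamma_2)=\mathrm{span}\{\gamma_1^{n-k}\gamma_2^{k}\}_{k=0}^n$ and $d(u,v)=\gamma_1(u)\gamma_2(v)-\gamma_2(u)\gamma_1(v)$. For $0\le k\le n$ put $G_{n,k}(t;h)=\sum_{I\subseteq\{1,\ldots,n\},\,|I|=k}\ \prod_{i\in I}\gamma_1(t-(i-1)h)\prod_{i\in\{1,\ldots,n\}\setminus I}\gamma_2(t-(i-1)h)$.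 Standing assumption: $h$ is such that the functions $t\mapsto G_{n,k}(t;h)$, $k=0,\ldots,n$, are linearly independent. The $h$--$\gamma$ blossom of $G\in\pi_n(\gamma_1,\gamma_2)$ is the (unique, existing) function $g(\cdot\,;h):(\mathbb R^2)^n\to\mathbb R$ that is symmetric, linear in each of its $n$ arguments in $\mathbb R^2$, and satisfies $g(\Gamma(t),\Gamma(t-h),\ldots,\Gamma(t-(n-1)h);h)=G(t)$ for all $t$. Argument lists such as $\Gamma(a-nh),\ldots,\Gamma(a-(n-1)h)$ or $\Gamma(b),\ldots,\Gamma(b+h)$ are empty. $h$--$\gamma$ Bernstein basis functions: $[a,b]$ denotes the interval determined by the endpoints $a,b$ in either order. Take arbitrary initial values $P_0^0,\ldots,P_n^0$ and define $$P_i^{k+1}(x)=\frac{d(x-kh,b-ih)}{d(a-(i+k)h,b-ih)}P_i^k(x)+\frac{d(a-(i+k)h,x-kh)}{d(a-(i+k)h,b-ih)}P_{i+1}^k(x),\quad 0\le i\le n-k-1,\ 0\le k\le n-1.$$ $B_k^n(x,[a,b];\gamma,h)$ is by definition the coefficient of $P_k^0$ in $P_0^n(x)$: $P_0^n(x)=\sum_{k=0}^nP_k^0\,B_k^n(x,[a,b];\gamma,h)$. *)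

theory Defs
  imports "HOL-Analysis.Analysis"
begin

text \<open>Linear independence and span of a finite family of real functions, given as a list.
  Families rather than sets are used so that repeated members count as dependent.\<close>

definition fun_lin_indep :: "(real \<Rightarrow> real) list \<Rightarrow> bool" where
  "fun_lin_indep fs \<longleftrightarrow>
     (\<forall>c :: nat \<Rightarrow> real. (\<forall>t. (\<Sum>i<length fs. c i * (fs ! i) t) = 0) \<longrightarrow> (\<forall>i<length fs. c i = 0))"

definition fun_span :: "(real \<Rightarrow> real) list \<Rightarrow> (real \<Rightarrow> real) set" where
  "fun_span fs = {f. \<exists>c :: nat \<Rightarrow> real. \<forall>t. f t = (\<Sum>i<length fs. c i * (fs ! i) t)}"

definition gamma_curve :: "(real \<Rightarrow> real) \<Rightarrow> (real \<Rightarrow> real) \<Rightarrow> real \<Rightarrow> real ^ 2" where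
  "gamma_curve \<gamma>1 \<gamma>2 t = vector [\<gamma>1 t, \<gamma>2 t]"

definition translation_invariant :: "(real \<Rightarrow> real) \<Rightarrow> (real \<Rightarrow> real) \<Rightarrow> bool" where
  "translation_invariant \<gamma>1 \<gamma>2 \<longleftrightarrow>
     (\<forall>s. \<exists>C :: real ^ 2 ^ 2. invertible C \<and>
        (\<forall>x. gamma_curve \<gamma>1 \<gamma>2 (x - s) = C *v gamma_curve \<gamma>1 \<gamma>2 x))"

definition gamma_poly :: "nat \<Rightarrow> (real \<Rightarrow> real) \<Rightarrow> (real \<Rightarrow> real) \<Rightarrow> (real \<Rightarrow> real) set" where
  "gamma_poly n \<gamma>1 \<gamma>2 = fun_span (map (\<lambda>k t. \<gamma>1 t ^ (n - k) * \<gamma>2 t ^ k) [0..<n + 1])"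

definition gamma_det :: "(real \<Rightarrow> real) \<Rightarrow> (real \<Rightarrow> real) \<Rightarrow> real \<Rightarrow> real \<Rightarrow> real" where
  "gamma_det \<gamma>1 \<gamma>2 u v = \<gamma>1 u * \<gamma>2 v - \<gamma>2 u * \<gamma>1 v"

definition G_fun ::
  "(real \<Rightarrow> real) \<Rightarrow> (real \<Rightarrow> real) \<Rightarrow> real \<Rightarrow> nat \<Rightarrow> nat \<Rightarrow> real \<Rightarrow> real" where
  "G_fun \<gamma>1 \<gamma>2 h n k t =
     (\<Sum>I | I \<subseteq> {1..n} \<and> card I = k.
        (\<Prod>i\<in>I. \<gamma>1 (t - (real i - 1) * h)) *
        (\<Prod>i\<in>{1..n} - I. \<gamma>2 (t - (real i - 1) * h)))"

text \<open>A function on the \<open>n\<close>-fold product of the plane is encoded as a function on lists of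
  vectors; only its values on lists of length \<open>n\<close> are constrained or used.\<close>

definition symmetric_multilinear :: "nat \<Rightarrow> ((real ^ 2) list \<Rightarrow> real) \<Rightarrow> bool" where
  "symmetric_multilinear n g \<longleftrightarrow>
     (\<forall>us vs. length us = n \<and> mset us = mset vs \<longrightarrow> g us = g vs) \<and>
     (\<forall>us i. length us = n \<and> i < n \<longrightarrow> linear (\<lambda>v. g (us[i := v])))"

definition is_blossom ::
  "(real \<Rightarrow> real) \<Rightarrow> (real \<Rightarrow> real) \<Rightarrow> real \<Rightarrow> nat \<Rightarrow> (real \<Rightarrow> real)
     \<Rightarrow> ((real ^ 2) list \<Rightarrow> real) \<Rightarrow> bool" where
  "is_blossom \<gamma>1 \<gamma>2 h n G g \<longleftrightarrow>
     symmetric_multilinear n g \<and>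
     (\<forall>t. g (map (\<lambda>j. gamma_curve \<gamma>1 \<gamma>2 (t - real j * h)) [0..<n]) = G t)"

text \<open>\<open>bern_rec \<gamma>1 \<gamma>2 h a b P k i x\<close> is $P_i^k(x)$ for the initial values $P_i^0 = P\,i$.
  The degree \<open>n\<close> only bounds the indices (\<open>i + k \<le> n\<close>); it does not enter the formula.\<close>

primrec bern_rec ::
  "(real \<Rightarrow> real) \<Rightarrow> (real \<Rightarrow> real) \<Rightarrow> real \<Rightarrow> real \<Rightarrow> real \<Rightarrow> (nat \<Rightarrow> real)
     \<Rightarrow> nat \<Rightarrow> nat \<Rightarrow> real \<Rightarrow> real" where
  "bern_rec \<gamma>1 \<gamma>2 h a b P 0 i x = P i"
| "bern_rec \<gamma>1 \<gamma>2 h a b P (Suc k) i x =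
     gamma_det \<gamma>1 \<gamma>2 (x - real k * h) (b - real i * h)
       / gamma_det \<gamma>1 \<gamma>2 (a - real (i + k) * h) (b - real i * h)
       * bern_rec \<gamma>1 \<gamma>2 h a b P k i x
   + gamma_det \<gamma>1 \<gamma>2 (a - real (i + k) * h) (x - real k * h)
       / gamma_det \<gamma>1 \<gamma>2 (a - real (i + k) * h) (b - real i * h)
       * bern_rec \<gamma>1 \<gamma>2 h a b P k (Suc i) x"

text \<open>The coefficient of $P_k^0$ in $P_0^n(x)$ is extracted by taking the \<open>k\<close>-th unit vector as
  initial values; \<open>bernstein_is_coefficient\<close> shows that this is the family of
  coefficients, and the only one.\<close>

definition bernstein ::
  "(real \<Rightarrow> real) \<Rightarrow> (real \<Rightarrow> real) \<Rightarrow> real \<Rightarrow> nat \<Rightarrow> nat \<Rightarrow> real \<Rightarrow> real \<Rightarrow> real \<Rightarrow> real" where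
  "bernstein \<gamma>1 \<gamma>2 h n k a b x = bern_rec \<gamma>1 \<gamma>2 h a b (\<lambda>j. if j = k then 1 else 0) n 0 x"

lemma bern_rec_expand:
  "i + m \<le> n \<Longrightarrow> bern_rec \<gamma>1 \<gamma>2 h a b P m i x =
     (\<Sum>k\<le>n. P k * bern_rec \<gamma>1 \<gamma>2 h a b (\<lambda>j. if j = k then 1 else 0) m i x)"
proof (induction m arbitrary: i)
  case 0
  have "(\<Sum>k\<le>n. P k * (if i = k then 1 else 0)) = (\<Sum>k\<le>n. if i = k then P k else 0)"
    by (rule sum.cong) auto
  also have "\<dots> = P i"
    using 0 by (subst sum.delta') auto
  finally show ?case
    unfolding bern_rec.simps(1) by (rule sym)
next
  case (Suc m)
  have eq: "u * (\<Sum>k\<le>n. P k * A k) + v * (\<Sum>k\<le>n. P k * B k)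
      = (\<Sum>k\<le>n. P k * (u * A k + v * B k))" for u v :: real and A B :: "nat \<Rightarrow> real"
    unfolding sum_distrib_left sum.distrib [symmetric]
    by (rule sum.cong) (auto simp: distrib_left)
  have le: "i + m \<le> n" "Suc i + m \<le> n"
    using Suc.prems by auto
  show ?case
    unfolding bern_rec.simps(2) Suc.IH [OF le(1)] Suc.IH [OF le(2)] by (rule eq)
qed

lemma bernstein_is_coefficient:
  fixes c :: "nat \<Rightarrow> real"
  shows "(\<forall>P. bern_rec \<gamma>1 \<gamma>2 h a b P n 0 x = (\<Sum>k\<le>n. P k * c k)) \<longleftrightarrow>
         (\<forall>k\<le>n. c k = bernstein \<gamma>1 \<gamma>2 h n k a b x)"
proof
  assume H: "\<forall>P. bern_rec \<gamma>1 \<gamma>2 h a b P n 0 x = (\<Sum>k\<le>n. P k * c k)"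
  show "\<forall>k\<le>n. c k = bernstein \<gamma>1 \<gamma>2 h n k a b x"
  proof (intro allI impI)
    fix k assume "k \<le> n"
    have "bernstein \<gamma>1 \<gamma>2 h n k a b x = (\<Sum>j\<le>n. (if j = k then 1 else 0) * c j)"
      unfolding bernstein_def using H by (rule spec)
    also have "\<dots> = (\<Sum>j\<le>n. if j = k then c j else 0)"
      by (rule sum.cong) auto
    also have "\<dots> = c k"
      using \<open>k \<le> n\<close> by (subst sum.delta) auto
    finally show "c k = bernstein \<gamma>1 \<gamma>2 h n k a b x"
      by (rule sym)
  qed
next
  assume c: "\<forall>k\<le>n. c k = bernstein \<gamma>1 \<gamma>2 h n k a b x"
  show "\<forall>P. bern_rec \<gamma>1 \<gamma>2 h a b P n 0 x = (\<Sum>k\<le>n. P k * c k)"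
  proof
    fix P
    have "bern_rec \<gamma>1 \<gamma>2 h a b P n 0 x = (\<Sum>k\<le>n. P k * bernstein \<gamma>1 \<gamma>2 h n k a b x)"
      unfolding bernstein_def by (rule bern_rec_expand) (rule eq_refl, rule add_0)
    also have "\<dots> = (\<Sum>k\<le>n. P k * c k)"
      by (rule sum.cong) (use c in auto)
    finally show "bern_rec \<gamma>1 \<gamma>2 h a b P n 0 x = (\<Sum>k\<le>n. P k * c k)" .
  qed
qed

end

theory Submission
  imports Defs "HOL-Computational_Algebra.Polynomial"
begin

text \<open>
  A symmetric multilinear form, evaluated at \<open>k\<close> points \<open>\<Gamma>(x), \<dots>, \<Gamma>(x - (k-1)h)\<close> and at the
  \<open>n - k\<close> remaining points of the lists in the theorem, satisfies the recursion
  of \<open>bern_rec\<close>: by Cramer's rule \<open>\<Gamma>(x - kh)\<close> is the combination of \<open>\<Gamma>(a - (i+k)h)\<close> and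
  \<open>\<Gamma>(b - ih)\<close> with exactly those coefficients. This gives the expansion of \<open>G\<close>. Applied to the
  forms whose diagonals are the \<open>G\<^bsub>n,k\<^esub>\<close>, it shows that the \<open>n + 1\<close> Bernstein functions span
  \<open>n + 1\<close> independent functions, hence are independent themselves, and the coefficients are unique.
\<close>

section \<open>Linear algebra over index sets\<close>

text \<open>Gaussian elimination, by induction on the set of equations: each equation costs at most
  one unknown.\<close>

lemma homogeneous_system_nontrivial:
  fixes A :: "'j \<Rightarrow> 'k \<Rightarrow> real"
  assumes "finite J" and "finite K" and "card J < card K"
  shows "\<exists>e. (\<exists>k\<in>K. e k \<noteq> 0) \<and> (\<forall>j\<in>J. (\<Sum>k\<in>K. e k * A j k) = 0)"
  using assms
proof (induction J arbitrary: K A rule: finite_induct)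
  case empty
  then show ?case
    by (intro exI [of _ "\<lambda>_. 1"]) (auto simp: card_gt_0_iff)
next
  case (insert j J)
  show ?case
  proof (cases "\<forall>k\<in>K. A j k = 0")
    case True
    have "card J < card K"
      using insert.hyps insert.prems by simp
    then obtain e where "\<exists>k\<in>K. e k \<noteq> 0" "\<forall>j\<in>J. (\<Sum>k\<in>K. e k * A j k) = 0"
      using insert.IH insert.prems by blast
    with True show ?thesis
      by (intro exI [of _ e]) simp
  next
    case False
    then obtain p where p: "p \<in> K" "A j p \<noteq> 0"
      by blast
    have "card J < card (K - {p})"
      using insert.hyps insert.prems p by simp
    \<comment> \<open>The unknown \<open>p\<close> is the pivot: equation \<open>j\<close> is solved
      for it and the result substituted into the other equations.\<close>
    then obtain e where e: "\<exists>k\<in>K - {p}. e k \<noteq> 0"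
      "\<forall>i\<in>J. (\<Sum>k\<in>K - {p}. e k * (A i k - A i p * A j k / A j p)) = 0"
      using insert.IH [of "K - {p}" "\<lambda>i k. A i k - A i p * A j k / A j p"] insert.prems by auto
    define s where "s = (\<Sum>k\<in>K - {p}. e k * A j k)"
    \<comment> \<open>The value at \<open>p\<close> is the one that back substitution into equation
      \<open>j\<close> forces.\<close>
    define f where "f = e(p := - s / A j p)"
    have split: "(\<Sum>k\<in>K. f k * A i k) = (\<Sum>k\<in>K - {p}. e k * A i k) - s / A j p * A i p" for i
    proof -
      have "(\<Sum>k\<in>K. f k * A i k) = f p * A i p + (\<Sum>k\<in>K - {p}. f k * A i k)"
        using insert.prems p by (simp add: sum.remove)
      also have "(\<Sum>k\<in>K - {p}. f k * A i k) = (\<Sum>k\<in>K - {p}. e k * A i k)"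
        by (rule sum.cong) (auto simp: f_def)
      finally show ?thesis
        by (simp add: f_def)
    qed
    have "(\<Sum>k\<in>K. f k * A i k) = 0" if "i \<in> J" for i
    proof -
      have "0 = (\<Sum>k\<in>K - {p}. e k * A i k - e k * A j k * (A i p / A j p))"
        using e(2) that by (simp add: algebra_simps)
      also have "\<dots> = (\<Sum>k\<in>K - {p}. e k * A i k) - s * (A i p / A j p)"
        by (simp only: sum_subtractf sum_distrib_right s_def)
      finally show ?thesis
        by (simp add: split)
    qed
    moreover have "(\<Sum>k\<in>K. f k * A j k) = 0"
      using p by (simp add: split s_def)
    moreover have "\<exists>k\<in>K. f k \<noteq> 0"
      using e(1) by (auto simp: f_def)
    ultimately show ?thesis
      by (intro exI [of _ f]) simp
  qed
qed

text \<open>The rows of \<open>M\<close> together with \<open>c\<close> are n + 2 vectors in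
  dimension n + 1, hence dependent. Pairing a dependence with the values of \<open>B\<close> kills
  the contribution of \<open>c\<close> and leaves a relation among the \<open>F k\<close>.\<close>

lemma spanning_family_independent:
  fixes F B :: "nat \<Rightarrow> 'x \<Rightarrow> real"
  assumes indep: "\<And>e. (\<And>x. (\<Sum>k\<le>n. e k * F k x) = 0) \<Longrightarrow> (\<forall>k\<le>n. e k = 0)"
    and span: "\<And>k x. k \<le> n \<Longrightarrow> F k x = (\<Sum>j\<le>n. M k j * B j x)"
    and zero: "\<And>x. (\<Sum>j\<le>n. c j * B j x) = 0"
    and "j \<le> n"
  shows "c j = 0"
proof -
  \<comment> \<open>The extra row is \<open>- c\<close>, so the relation expresses
    \<open>e (Suc n)\<close> times \<open>c\<close> through the rows of \<open>M\<close>.\<close>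
  obtain e where e: "\<exists>k\<in>{..Suc n}. e k \<noteq> 0"
    "\<forall>j\<in>{..n}. (\<Sum>k\<le>Suc n. e k * (if k = Suc n then - c j else M k j)) = 0"
    using homogeneous_system_nontrivial
      [of "{..n}" "{..Suc n}" "\<lambda>j k. if k = Suc n then - c j else M k j"]
    by auto
  have comb: "(\<Sum>k\<le>n. e k * M k j) = e (Suc n) * c j" if "j \<le> n" for j
    using e(2) that by (simp add: atMost_Suc)
  have "(\<Sum>k\<le>n. e k * F k x) = 0" for x
  proof -
    have "(\<Sum>k\<le>n. e k * F k x) = (\<Sum>k\<le>n. \<Sum>j\<le>n. e k * M k j * B j x)"
      by (simp add: span sum_distrib_left mult.assoc)
    also have "\<dots> = (\<Sum>j\<le>n. \<Sum>k\<le>n. e k * M k j * B j x)"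
      by (rule sum.swap)
    also have "\<dots> = (\<Sum>j\<le>n. e (Suc n) * (c j * B j x))"
    proof (rule sum.cong)
      fix j assume "j \<in> {..n}"
      then show "(\<Sum>k\<le>n. e k * M k j * B j x) = e (Suc n) * (c j * B j x)"
        using comb [of j] by (simp only: flip: sum_distrib_right) simp
    qed simp
    also have "\<dots> = e (Suc n) * (\<Sum>j\<le>n. c j * B j x)"
      by (simp add: sum_distrib_left)
    finally show ?thesis
      by (simp add: zero)
  qed
  then have e0: "\<forall>k\<le>n. e k = 0"
    by (rule indep)
  \<comment> \<open>The relation is nontrivial and all its other coefficients vanish.\<close>
  with e(1) have "e (Suc n) \<noteq> 0"
    by (auto simp: le_Suc_eq)
  moreover have "e (Suc n) * c j = 0"
    using comb [OF \<open>j \<le> n\<close>] e0 by simp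
  ultimately show ?thesis
    by simp
qed

section \<open>Blossom values along the recursion\<close>

text \<open>In each coordinate this is the three-term identity d(p,q) f(y) = d(y,q) f(p) + d(p,y)
  f(q), divided by d(p,q).\<close>

lemma gamma_curve_cramer:
  assumes "gamma_det \<gamma>1 \<gamma>2 p q \<noteq> 0"
  shows "gamma_curve \<gamma>1 \<gamma>2 y =
      (gamma_det \<gamma>1 \<gamma>2 y q / gamma_det \<gamma>1 \<gamma>2 p q) *\<^sub>R gamma_curve \<gamma>1 \<gamma>2 p
    + (gamma_det \<gamma>1 \<gamma>2 p y / gamma_det \<gamma>1 \<gamma>2 p q) *\<^sub>R gamma_curve \<gamma>1 \<gamma>2 q"
proof -
  have "gamma_det \<gamma>1 \<gamma>2 p q * f y =
      gamma_det \<gamma>1 \<gamma>2 y q * f p + gamma_det \<gamma>1 \<gamma>2 p y * f q" if "f \<in> {\<gamma>1, \<gamma>2}" for f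
    using that by (auto simp: gamma_det_def algebra_simps)
  then have "f y = gamma_det \<gamma>1 \<gamma>2 y q / gamma_det \<gamma>1 \<gamma>2 p q * f p
      + gamma_det \<gamma>1 \<gamma>2 p y / gamma_det \<gamma>1 \<gamma>2 p q * f q" if "f \<in> {\<gamma>1, \<gamma>2}" for f
    using that assms by (simp add: field_simps)
  from this [of \<gamma>1] this [of \<gamma>2]
  have "\<gamma>1 y = gamma_det \<gamma>1 \<gamma>2 y q / gamma_det \<gamma>1 \<gamma>2 p q * \<gamma>1 p
      + gamma_det \<gamma>1 \<gamma>2 p y / gamma_det \<gamma>1 \<gamma>2 p q * \<gamma>1 q"
    "\<gamma>2 y = gamma_det \<gamma>1 \<gamma>2 y q / gamma_det \<gamma>1 \<gamma>2 p q * \<gamma>2 p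
      + gamma_det \<gamma>1 \<gamma>2 p y / gamma_det \<gamma>1 \<gamma>2 p q * \<gamma>2 q"
    by simp_all
  then show ?thesis
    by (simp add: vec_eq_iff forall_2 gamma_curve_def)
qed

lemma symmetric_multilinear_Cons:
  assumes "symmetric_multilinear n g" and "Suc (length R) = n"
  shows "linear (\<lambda>v. g (v # R))"
proof -
  \<comment> \<open>The entry 0 is a placeholder that the update overwrites.\<close>
  have "linear (\<lambda>v. g ((0 # R)[0 := v]))"
    using assms unfolding symmetric_multilinear_def by (metis length_Cons zero_less_Suc)
  then show ?thesis
    by simp
qed

lemma bern_rec_blossom_values:
  fixes g :: "(real ^ 2) list \<Rightarrow> real"
  assumes g: "symmetric_multilinear n g"
    and nz: "\<And>i j. i \<le> j \<Longrightarrow> j < n \<Longrightarrow>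
      gamma_det \<gamma>1 \<gamma>2 (a - real j * h) (b - real i * h) \<noteq> 0"
    and "i + k \<le> n"
  shows "bern_rec \<gamma>1 \<gamma>2 h a b
      (\<lambda>k. g (map (\<lambda>j. gamma_curve \<gamma>1 \<gamma>2 (a - real j * h)) [k..<n]
        @ map (\<lambda>j. gamma_curve \<gamma>1 \<gamma>2 (b - real j * h)) [0..<k])) k i x
    = g (map (\<lambda>j. gamma_curve \<gamma>1 \<gamma>2 (a - real j * h)) [i + k..<n]
        @ map (\<lambda>j. gamma_curve \<gamma>1 \<gamma>2 (b - real j * h)) [0..<i]
        @ map (\<lambda>j. gamma_curve \<gamma>1 \<gamma>2 (x - real j * h)) [0..<k])"
  using \<open>i + k \<le> n\<close>
proof (induction k arbitrary: i)
  case 0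
  then show ?case by simp
next
  case (Suc k)
  let ?C = "\<lambda>y j. gamma_curve \<gamma>1 \<gamma>2 (y - real j * h)"
  let ?L = "\<lambda>i k. map (?C a) [i + k..<n] @ map (?C b) [0..<i] @ map (?C x) [0..<k]"
  let ?d = "gamma_det \<gamma>1 \<gamma>2"
  let ?p = "a - real (i + k) * h" and ?q = "b - real i * h" and ?y = "x - real k * h"
  \<comment> \<open>The n - 1 arguments shared by the three values in one recursion step. The
    missing argument is \<open>?p\<close>, \<open>?q\<close> or \<open>?y\<close>; symmetry moves it
    to the front.\<close>
  define R where "R = map (?C a) [Suc (i + k)..<n] @ map (?C b) [0..<i] @ map (?C x) [0..<k]"
  have sym: "g us = g vs" if "length us = n" "mset us = mset vs" for us vs
    using g that unfolding symmetric_multilinear_def by blast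
  have R: "Suc (length R) = n"
    using Suc.prems by (simp add: R_def)
  note lin = symmetric_multilinear_Cons [OF g R]
  have L1: "g (?L i k) = g (gamma_curve \<gamma>1 \<gamma>2 ?p # R)"
    using Suc.prems by (simp add: R_def upt_conv_Cons)
  have L2: "g (?L (Suc i) k) = g (gamma_curve \<gamma>1 \<gamma>2 ?q # R)"
    by (rule sym) (use Suc.prems in \<open>simp_all add: R_def\<close>)
  have L3: "g (?L i (Suc k)) = g (gamma_curve \<gamma>1 \<gamma>2 ?y # R)"
    by (rule sym) (use Suc.prems in \<open>simp_all add: R_def\<close>)
  have "?d ?p ?q \<noteq> 0"
    using Suc.prems by (intro nz) auto
  then have "g (gamma_curve \<gamma>1 \<gamma>2 ?y # R) =
      ?d ?y ?q / ?d ?p ?q * g (gamma_curve \<gamma>1 \<gamma>2 ?p # R)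
    + ?d ?p ?y / ?d ?p ?q * g (gamma_curve \<gamma>1 \<gamma>2 ?q # R)"
    by (subst gamma_curve_cramer [of \<gamma>1 \<gamma>2 ?p ?q ?y])
      (simp_all add: linear_add [OF lin] linear_scale [OF lin])
  moreover have "i + k \<le> n" "Suc i + k \<le> n"
    using Suc.prems by auto
  ultimately show ?case
    unfolding bern_rec.simps(2) Suc.IH [OF \<open>i + k \<le> n\<close>] Suc.IH [OF \<open>Suc i + k \<le> n\<close>] L1 L2 L3
    by simp
qed

text \<open>For \<open>i = 0\<close> and \<open>k = n\<close> only arguments depending on
  \<open>x\<close> remain, and the recursion is linear in its initial values.\<close>

lemma blossom_bernstein_expansion:
  assumes "symmetric_multilinear n g"
    and "\<And>i j. i \<le> j \<Longrightarrow> j < n \<Longrightarrow>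
      gamma_det \<gamma>1 \<gamma>2 (a - real j * h) (b - real i * h) \<noteq> 0"
  shows "g (map (\<lambda>j. gamma_curve \<gamma>1 \<gamma>2 (x - real j * h)) [0..<n]) =
    (\<Sum>k\<le>n. g (map (\<lambda>j. gamma_curve \<gamma>1 \<gamma>2 (a - real j * h)) [k..<n]
        @ map (\<lambda>j. gamma_curve \<gamma>1 \<gamma>2 (b - real j * h)) [0..<k])
      * bernstein \<gamma>1 \<gamma>2 h n k a b x)"
  using bern_rec_blossom_values [OF assms, of 0 n x]
    bernstein_is_coefficient [of \<gamma>1 \<gamma>2 h a b n x "\<lambda>k. bernstein \<gamma>1 \<gamma>2 h n k a b x"]
  by simp

section \<open>Symmetric forms with diagonals \<open>G_fun\<close>\<close>

text \<open>The polarisation of \<open>u\<^sub>1\<^sup>k u\<^sub>2\<^sup>n\<^sup>-\<^sup>k\<close> up to a factor, read off a generating polynomial so that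
  symmetry comes for free.\<close>

definition coeff_form :: "nat \<Rightarrow> (real ^ 2) list \<Rightarrow> real" where
  "coeff_form k us = poly.coeff (\<Prod>v\<leftarrow>us. [:v $ 2, v $ 1:]) k"

lemma symmetric_multilinear_coeff_form: "symmetric_multilinear n (coeff_form k)"
  unfolding symmetric_multilinear_def
proof (intro conjI allI impI)
  fix us vs :: "(real ^ 2) list"
  assume "length us = n \<and> mset us = mset vs"
  then have "prod_mset (image_mset (\<lambda>v. [:v $ 2, v $ 1:]) (mset us)) =
      prod_mset (image_mset (\<lambda>v. [:v $ 2, v $ 1:]) (mset vs))"
    by simp
  then show "coeff_form k us = coeff_form k vs"
    by (simp only: coeff_form_def prod_mset_prod_list flip: mset_map)
next
  fix us :: "(real ^ 2) list" and i
  assume "length us = n \<and> i < n"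
  then have i: "i < length us" by simp
  \<comment> \<open>Only the \<open>i\<close>-th factor contains \<open>v\<close>, and its
    coefficients are coordinates of \<open>v\<close>; \<open>q\<close> collects the other
    factors.\<close>
  define q where "q = (\<Prod>v\<leftarrow>take i us. [:v $ 2, v $ 1:]) * (\<Prod>v\<leftarrow>drop (Suc i) us. [:v $ 2, v $ 1:])"
  have "coeff_form k (us[i := v]) = v $ 2 * poly.coeff q k + v $ 1 * poly.coeff (pCons 0 q) k" for v
  proof -
    have "(\<Prod>v\<leftarrow>us[i := v]. [:v $ 2, v $ 1:]) = [:v $ 2, v $ 1:] * q"
      using i by (simp only: upd_conv_take_nth_drop q_def) (simp add: mult_ac del: mult_pCons_left mult_pCons_right)
    also have "\<dots> = smult (v $ 2) q + smult (v $ 1) (pCons 0 q)"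
      by simp
    finally show ?thesis
      unfolding coeff_form_def by (simp add: coeff_pCons split: nat.split)
  qed
  then show "linear (\<lambda>v. coeff_form k (us[i := v]))"
    by (auto intro!: linearI simp: algebra_simps)
qed

text \<open>On expanding the product, \<open>I\<close> is the set of factors that contribute their
  linear term, so its cardinality is the degree.\<close>

lemma coeff_prod_linear_factors:
  fixes u v :: "'i \<Rightarrow> 'a::comm_ring_1"
  assumes "finite A"
  shows "poly.coeff (\<Prod>i\<in>A. [:v i, u i:]) k =
    (\<Sum>I | I \<subseteq> A \<and> card I = k. (\<Prod>i\<in>I. u i) * (\<Prod>i\<in>A - I. v i))"
proof -
  have mon: "(\<Prod>i\<in>I. monom (u i) 1) * (\<Prod>i\<in>J. [:v i:]) = monom ((\<Prod>i\<in>I. u i) * (\<Prod>i\<in>J. v i)) (card I)"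
    if "finite I" "finite J" for I J
  proof -
    have "(\<Prod>i\<in>I. monom (u i) 1) = monom (\<Prod>i\<in>I. u i) (card I)"
      using that(1) by (induction I rule: finite_induct) (simp_all add: mult_monom)
    moreover have "(\<Prod>i\<in>J. [:v i:]) = monom (\<Prod>i\<in>J. v i) 0"
      using that(2) by (induction J rule: finite_induct) (simp_all add: monom_0)
    ultimately show ?thesis
      by (simp add: mult_monom)
  qed
  have "(\<Prod>i\<in>A. [:v i, u i:]) = (\<Prod>i\<in>A. monom (u i) 1 + [:v i:])"
    by (simp add: monom_Suc monom_0)
  also have "\<dots> = (\<Sum>I\<in>Pow A. (\<Prod>i\<in>I. monom (u i) 1) * (\<Prod>i\<in>A - I. [:v i:]))"
    using assms by (rule prod_add)
  also have "\<dots> = (\<Sum>I\<in>Pow A. monom ((\<Prod>i\<in>I. u i) * (\<Prod>i\<in>A - I. v i)) (card I))"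
    using assms by (intro sum.cong mon refl) (auto intro: finite_subset)
  finally have "poly.coeff (\<Prod>i\<in>A. [:v i, u i:]) k =
      (\<Sum>I\<in>Pow A. if card I = k then (\<Prod>i\<in>I. u i) * (\<Prod>i\<in>A - I. v i) else 0)"
    by (simp add: coeff_sum)
  also have "\<dots> = (\<Sum>I | I \<in> Pow A \<and> card I = k. (\<Prod>i\<in>I. u i) * (\<Prod>i\<in>A - I. v i))"
    using assms by (intro sum.inter_filter [symmetric]) simp
  finally show ?thesis
    by simp
qed

lemma coeff_form_diagonal:
  "coeff_form k (map (\<lambda>j. gamma_curve \<gamma>1 \<gamma>2 (t - real j * h)) [0..<n]) = G_fun \<gamma>1 \<gamma>2 h n k t"
proof -
  have "(\<Prod>v\<leftarrow>map (\<lambda>j. gamma_curve \<gamma>1 \<gamma>2 (t - real j * h)) [0..<n]. [:v $ 2, v $ 1:])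
      = (\<Prod>j\<in>{0..<n}. [:\<gamma>2 (t - real j * h), \<gamma>1 (t - real j * h):])"
    by (simp add: gamma_curve_def o_def prod.distinct_set_conv_list [of "[0..<n]", simplified])
  \<comment> \<open>Argument lists count from 0, while \<open>G_fun\<close> counts from 1 and shifts
    by \<open>i - 1\<close>.\<close>
  also have "\<dots> = (\<Prod>i\<in>{1..n}. [:\<gamma>2 (t - (real i - 1) * h), \<gamma>1 (t - (real i - 1) * h):])"
    by (rule prod.reindex_bij_witness [of _ "\<lambda>i. i - 1" Suc]) (auto simp: of_nat_diff)
  finally show ?thesis
    by (simp add: coeff_form_def G_fun_def coeff_prod_linear_factors)
qed

section \<open>Uniqueness and the control points\<close>

lemma bernstein_independent:
  assumes indep: "fun_lin_indep (map (\<lambda>k. G_fun \<gamma>1 \<gamma>2 h n k) [0..<n + 1])"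
    and nz: "\<And>i j. i \<le> j \<Longrightarrow> j < n \<Longrightarrow>
      gamma_det \<gamma>1 \<gamma>2 (a - real j * h) (b - real i * h) \<noteq> 0"
    and zero: "\<And>x. (\<Sum>k\<le>n. c k * bernstein \<gamma>1 \<gamma>2 h n k a b x) = 0"
    and "k \<le> n"
  shows "c k = 0"
proof (rule spanning_family_independent [where n = n and F = "\<lambda>k. G_fun \<gamma>1 \<gamma>2 h n k"])
  show "\<forall>k\<le>n. e k = 0" if "\<And>x. (\<Sum>k\<le>n. e k * G_fun \<gamma>1 \<gamma>2 h n k x) = 0" for e
  proof -
    have "(\<Sum>i<n + 1. e i * (map (\<lambda>k. G_fun \<gamma>1 \<gamma>2 h n k) [0..<n + 1] ! i) t) =
        (\<Sum>k\<le>n. e k * G_fun \<gamma>1 \<gamma>2 h n k t)" for t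
      by (rule sum.cong) (auto simp del: upt_Suc)
    with that indep show ?thesis
      unfolding fun_lin_indep_def by (auto simp del: upt_Suc simp: less_Suc_eq_le)
  qed
  \<comment> \<open>The matrix of the spanning relation consists of the values of
    \<open>coeff_form m\<close> at the control arguments.\<close>
  show "G_fun \<gamma>1 \<gamma>2 h n m x =
    (\<Sum>k\<le>n. coeff_form m (map (\<lambda>j. gamma_curve \<gamma>1 \<gamma>2 (a - real j * h)) [k..<n]
        @ map (\<lambda>j. gamma_curve \<gamma>1 \<gamma>2 (b - real j * h)) [0..<k])
      * bernstein \<gamma>1 \<gamma>2 h n k a b x)" for m x
    unfolding coeff_form_diagonal [symmetric]
    by (rule blossom_bernstein_expansion [OF symmetric_multilinear_coeff_form nz])
qed (use zero \<open>k \<le> n\<close> in auto)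

theorem theorem5p8:
  fixes n :: nat and h a b :: real
    and \<gamma>1 \<gamma>2 G :: "real \<Rightarrow> real"
    and g :: "(real ^ 2) list \<Rightarrow> real"
  assumes "n \<ge> 1"
    and "continuous_on UNIV \<gamma>1" and "continuous_on UNIV \<gamma>2"
    and "fun_lin_indep [\<gamma>1, \<gamma>2]"
    and "translation_invariant \<gamma>1 \<gamma>2"
    and "fun_lin_indep (map (\<lambda>k. G_fun \<gamma>1 \<gamma>2 h n k) [0..<n + 1])"
    and "\<forall>i j. i \<le> j \<and> j \<le> n - 1 \<longrightarrow>
           gamma_det \<gamma>1 \<gamma>2 (a - real j * h) (b - real i * h) \<noteq> 0"
    and "G \<in> gamma_poly n \<gamma>1 \<gamma>2"
    and "is_blossom \<gamma>1 \<gamma>2 h n G g"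
  shows "\<forall>c :: nat \<Rightarrow> real.
           (\<forall>x. G x = (\<Sum>k\<le>n. c k * bernstein \<gamma>1 \<gamma>2 h n k a b x)) \<longleftrightarrow>
           (\<forall>k\<le>n. c k =
              g (map (\<lambda>j. gamma_curve \<gamma>1 \<gamma>2 (a - real j * h)) [k..<n]
               @ map (\<lambda>j. gamma_curve \<gamma>1 \<gamma>2 (b - real j * h)) [0..<k]))"
proof
  fix c :: "nat \<Rightarrow> real"
  let ?B = "\<lambda>k x. bernstein \<gamma>1 \<gamma>2 h n k a b x"
  let ?v = "\<lambda>k. g (map (\<lambda>j. gamma_curve \<gamma>1 \<gamma>2 (a - real j * h)) [k..<n]
    @ map (\<lambda>j. gamma_curve \<gamma>1 \<gamma>2 (b - real j * h)) [0..<k])"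
  have nz: "gamma_det \<gamma>1 \<gamma>2 (a - real j * h) (b - real i * h) \<noteq> 0" if "i \<le> j" "j < n" for i j
    using assms(7) that by simp
  have G: "G x = (\<Sum>k\<le>n. ?v k * ?B k x)" for x
  proof -
    have "G x = g (map (\<lambda>j. gamma_curve \<gamma>1 \<gamma>2 (x - real j * h)) [0..<n])"
      using assms(9) by (simp add: is_blossom_def)
    also have "\<dots> = (\<Sum>k\<le>n. ?v k * ?B k x)"
      using assms(9) nz by (intro blossom_bernstein_expansion) (auto simp: is_blossom_def)
    finally show ?thesis .
  qed
  show "(\<forall>x. G x = (\<Sum>k\<le>n. c k * ?B k x)) \<longleftrightarrow> (\<forall>k\<le>n. c k = ?v k)"
  proof (intro iffI allI impI)
    fix k assume H: "\<forall>x. G x = (\<Sum>k\<le>n. c k * ?B k x)" and "k \<le> n"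
    \<comment> \<open>Both \<open>c\<close> and \<open>?v\<close> represent \<open>G\<close>, so
      their difference represents zero.\<close>
    have "(\<Sum>k\<le>n. (c k - ?v k) * ?B k x) = 0" for x
      using G [of x] H by (simp add: left_diff_distrib sum_subtractf)
    then have "c k - ?v k = 0"
      using \<open>k \<le> n\<close>
      by (intro bernstein_independent [OF assms(6) nz, where c = "\<lambda>k. c k - ?v k" and k = k])
    then show "c k = ?v k"
      by simp
  next
    fix x assume "\<forall>k\<le>n. c k = ?v k"
    then show "G x = (\<Sum>k\<le>n. c k * ?B k x)"
      unfolding G by (intro sum.cong) auto
  qed
qed

end
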